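(* There exists a $1$-Lipschitz map $f \colon S_{\ell_\infty} \to [0,1]$ such that for every vector subspace $X \subseteq \ell_\infty$ that is linearly isometric to $\ell_\infty$, one has $f(S_X) = [0,1]$.
   Context: $\ell_\infty$ is the real Banach space of all bounded sequences $x \colon \mathbb{N} \to \mathbb{R}$ with the norm $\|x\|_\infty = \sup_{n \in \mathbb{N}} |x(n)|$. For a Banach space $X$, $S_X$ denotes its unit sphere, i.e. the set of its vectors of norm $1$. The Lipschitz condition is with respect to the norm metric. *)

theory Defs
  imports "HOL-Analysis.Analysis"
begin

text \<open>
  The topology on \<^typ>\<open>nat\<close> is discrete, so the bounded continuous functions
  \<^typ>\<open>nat \<Rightarrow>\<^sub>C real\<close> are exactly the bounded real sequences, and the library norm on this
  type is the supremum norm (lemmas below).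
\<close>

type_synonym linfty = "nat \<Rightarrow>\<^sub>C real"

lemma linfty_iff_bounded:
  fixes x :: "nat \<Rightarrow> real"
  shows "x \<in> range (apply_bcontfun :: linfty \<Rightarrow> nat \<Rightarrow> real) \<longleftrightarrow> bounded (range x)"
proof -
  have "range (apply_bcontfun :: linfty \<Rightarrow> nat \<Rightarrow> real) = bcontfun"
    using type_definition.Rep_range[OF type_definition_bcontfun] .
  then show ?thesis
    by (simp add: bcontfun_def)
qed

lemma norm_linfty:
  fixes x :: linfty
  shows "norm x = (SUP n. \<bar>apply_bcontfun x n\<bar>)"
  by (simp add: norm_bcontfun_def dist_bcontfun.rep_eq zero_bcontfun.rep_eq)

text \<open>A linear isometry is not required to be onto its codomain, hence the condition on the range.\<close>

definition linearly_isometric_to ::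
  "'a::real_normed_vector set \<Rightarrow> 'b::real_normed_vector itself \<Rightarrow> bool" where
  "linearly_isometric_to X _ \<longleftrightarrow>
     (\<exists>T :: 'b \<Rightarrow> 'a. linear T \<and> (\<forall>x. norm (T x) = norm x) \<and> range T = X)"

end

theory Submission
  imports Defs
begin

text \<open>
  It suffices to find a set \<open>A\<close> of unit vectors that meets every isometric copy of
  \<open>\<ell>\<^sub>\<infinity>\<close> and satisfies \<open>\<parallel>a + b\<parallel> \<ge> 1\<close> for all \<open>a, b \<in> A\<close>. Indeed, let
  \<open>f x = min 1 (dist (x, A))\<close>. If \<open>a \<in> A\<close> lies in a copy \<open>X\<close>, then \<open>f a = 0\<close>, while
  \<open>f (-a) = 1\<close> because \<open>-a\<close> has distance at least 1 from \<open>A\<close>; the points \<open>a\<close> and \<open>-a\<close> are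
  joined by a path in the unit sphere of \<open>X\<close>, so \<open>f\<close> takes all values in between.

  The set \<open>A\<close> is built by transfinite recursion. A copy of \<open>\<ell>\<^sub>\<infinity>\<close> contains the images of
  all sequences of signs, which are continuum many vectors at mutual distance 2. A vector
  chosen earlier is within distance less than 1 of the negative of at most one of them, so
  a good choice remains as long as fewer than continuum many vectors were chosen before
  (\<open>transfinite_choice_avoiding\<close>).

  The obstacle is that \<open>\<ell>\<^sub>\<infinity>\<close> is not separable, so that there can be more than continuum
  many isometric embeddings. An embedding for which every coordinate of the image is
  continuous along initial segments of the argument is determined by an infinite real
  matrix, however, and there are only continuum many of these
  (\<open>card_matrix_isometries\<close>). Every copy of \<open>\<ell>\<^sub>\<infinity>\<close> contains the range of such an
  embedding (\<open>matrix_isometry_inside_isometry\<close>): restrict a given embedding to the sequences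
  supported on one member of an uncountable almost disjoint family of sets. Each of the
  countably many coordinate functionals can have a part that does not vanish at infinity
  on only countably many members of the family, so some member is good for all of them.
\<close>

section \<open>A transfinite choice principle\<close>

unbundle cardinal_syntax

text \<open>
  Read \<open>C i e j d\<close> as a conflict between giving \<open>e\<close> to \<open>i\<close> and \<open>d\<close> to \<open>j\<close>. Well-order \<open>I\<close>
  in order type its cardinality. When the turn of \<open>i\<close> comes, every predecessor excludes at
  most one element, and there are fewer predecessors than elements to choose from.
\<close>
lemma transfinite_choice_avoiding:
  fixes C :: "'i \<Rightarrow> 'e \<Rightarrow> 'i \<Rightarrow> 'e \<Rightarrow> bool"
  assumes card: "|I| \<le>o |UNIV :: 'e set|"
    and few: "\<And>i j d e e'. i \<in> I \<Longrightarrow> j \<in> I \<Longrightarrow> C i e j d \<Longrightarrow> C i e' j d \<Longrightarrow> e = e'"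
    and sym: "\<And>i j d e. C i e j d \<Longrightarrow> C j d i e"
  shows "\<exists>g. \<forall>i\<in>I. \<forall>j\<in>I. i \<noteq> j \<longrightarrow> \<not> C i (g i) j (g j)"
proof -
  let ?r = "|I| - Id"
  have Field: "Field |I| = I"
    by (rule Field_card_of)
  have "wf ?r"
    using card_of_well_order_on[of I] by (simp add: well_order_on_def)
  have ex: "\<exists>e. i \<in> I \<longrightarrow> (\<forall>j. (j, i) \<in> ?r \<longrightarrow> \<not> C i e j (h j))" for i :: 'i and h
  proof (cases "i \<in> I")
    case True
    let ?U = "underS |I| i"
    \<comment> \<open>The elements excluded by the predecessors; \<open>K\<close> may contain junk values of \<open>SOME\<close>.\<close>
    define K where "K = (\<lambda>j. SOME e. C i e j (h j)) ` ?U"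
    have U: "j \<in> I" if "j \<in> ?U" for j
      using that Field by (auto simp: underS_def Field_def)
    have bad: "e \<in> K" if "j \<in> ?U" "C i e j (h j)" for e j
    proof -
      have "C i (SOME e. C i e j (h j)) j (h j)"
        using that(2) by (rule someI)
      then have "e = (SOME e. C i e j (h j))"
        using few[OF True U[OF that(1)] that(2)] by blast
      then show ?thesis
        using that(1) unfolding K_def by blast
    qed
    have "|K| \<le>o |?U|"
      unfolding K_def by (rule card_of_image)
    moreover have "|?U| <o |I|"
      using True Field by (intro card_of_underS card_of_Card_order) simp
    ultimately have "|K| <o |UNIV :: 'e set|"
      using card ordLeq_ordLess_trans ordLess_ordLeq_trans by blast
    then have "K \<noteq> UNIV"
      using ordLess_irreflexive by blast
    then obtain e where "e \<notin> K"
      by blast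
    then have "\<not> C i e j (h j)" if "(j, i) \<in> ?r" for j
      using bad[of j e] that by (auto simp: underS_def)
    then show ?thesis
      by blast
  qed blast
  have "\<exists>g. \<forall>i. i \<in> I \<longrightarrow> (\<forall>j. (j, i) \<in> ?r \<longrightarrow> \<not> C i (g i) j (g j))"
    by (rule dependent_wf_choice[OF \<open>wf ?r\<close>, where P = "\<lambda>g i e. i \<in> I \<longrightarrow> (\<forall>j. (j, i) \<in> ?r \<longrightarrow> \<not> C i e j (g j))"])
      (use ex in auto)
  then obtain g where g: "\<And>i j. i \<in> I \<Longrightarrow> (j, i) \<in> ?r \<Longrightarrow> \<not> C i (g i) j (g j)"
    by blast
  have "\<not> C i (g i) j (g j)" if "i \<in> I" "j \<in> I" "i \<noteq> j" for i j
  proof -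
    have "(i, j) \<in> |I| \<or> (j, i) \<in> |I|"
      using card_of_well_order_on[of I] that unfolding well_order_on_def linear_order_on_def total_on_def Field by blast
    then show ?thesis
      using g[of i j] g[of j i] that sym by auto
  qed
  then show ?thesis
    by blast
qed

section \<open>Operations on bounded sequences\<close>

definition restr :: "nat set \<Rightarrow> linfty \<Rightarrow> linfty" where
  "restr A x = Bcontfun (\<lambda>n. if n \<in> A then apply_bcontfun x n else 0)"

text \<open>
  This isometry copies a sequence onto the range of an injection \<open>m\<close>, placing entry \<open>i\<close> at
  position \<open>m i\<close>.
\<close>
definition push :: "(nat \<Rightarrow> nat) \<Rightarrow> linfty \<Rightarrow> linfty" where
  "push m x = Bcontfun (\<lambda>n. if n \<in> range m then apply_bcontfun x (inv m n) else 0)"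

definition sign_seq :: "nat set \<Rightarrow> linfty" where
  "sign_seq E = Bcontfun (\<lambda>n. if n \<in> E then 1 else - 1)"

definition unit_seq :: "nat \<Rightarrow> linfty" where
  "unit_seq j = Bcontfun (\<lambda>n. if n = j then 1 else 0)"

lemma apply_Bcontfun_seq:
  fixes g :: "nat \<Rightarrow> real"
  assumes "\<And>n. \<bar>g n\<bar> \<le> b"
  shows "apply_bcontfun (Bcontfun g) = g"
  using assms by (intro Bcontfun_inverse bcontfun_normI) auto

lemma abs_le_norm: "\<bar>apply_bcontfun (x :: linfty) n\<bar> \<le> norm x"
  using norm_bounded[of x n] by simp

lemma apply_restr [simp]: "apply_bcontfun (restr A x) n = (if n \<in> A then apply_bcontfun x n else 0)"
  unfolding restr_def by (subst apply_Bcontfun_seq[where b = "norm x"]) (auto simp: abs_le_norm)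

lemma apply_push: "apply_bcontfun (push m x) n = (if n \<in> range m then apply_bcontfun x (inv m n) else 0)"
  unfolding push_def by (subst apply_Bcontfun_seq[where b = "norm x"]) (auto simp: abs_le_norm)

lemma apply_sign_seq [simp]: "apply_bcontfun (sign_seq E) n = (if n \<in> E then 1 else - 1)"
  unfolding sign_seq_def by (subst apply_Bcontfun_seq[where b = 1]) auto

lemma apply_unit_seq [simp]: "apply_bcontfun (unit_seq j) n = (if n = j then 1 else 0)"
  unfolding unit_seq_def by (subst apply_Bcontfun_seq[where b = 1]) auto

lemma push_at: "inj m \<Longrightarrow> apply_bcontfun (push m x) (m i) = apply_bcontfun x i"
  by (simp add: apply_push)

lemma norm_le_if_coords:
  fixes x :: linfty
  shows "(\<And>n. \<bar>apply_bcontfun x n\<bar> \<le> b) \<Longrightarrow> norm x \<le> b"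
  by (rule norm_bound) simp

lemma norm_restr_le: "norm (restr A x) \<le> norm x"
  by (rule norm_le_if_coords) (auto simp: abs_le_norm)

lemma linear_restr: "linear (restr A)"
  by (rule linearI) (auto intro!: bcontfun_eqI)

lemma linear_push: "linear (push m)"
  by (rule linearI) (auto intro!: bcontfun_eqI simp: apply_push)

lemma norm_push:
  assumes "inj m"
  shows "norm (push m x) = norm x"
proof (rule antisym)
  show "norm (push m x) \<le> norm x"
    by (rule norm_le_if_coords) (auto simp: apply_push abs_le_norm)
  show "norm x \<le> norm (push m x)"
    by (rule norm_le_if_coords) (metis abs_le_norm assms push_at)
qed

lemma norm_sign_seq [simp]: "norm (sign_seq E) = 1"
proof (rule antisym)
  show "norm (sign_seq E) \<le> 1"
    by (rule norm_le_if_coords) auto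
  show "1 \<le> norm (sign_seq E)"
    using abs_le_norm[of "sign_seq E" 0] by (auto split: if_splits)
qed

lemma norm_sign_seq_diff:
  assumes "E \<noteq> F"
  shows "norm (sign_seq E - sign_seq F) \<ge> 2"
proof -
  obtain n where "n \<in> E \<longleftrightarrow> n \<notin> F"
    using assms by blast
  then have "\<bar>apply_bcontfun (sign_seq E - sign_seq F) n\<bar> = 2"
    by auto
  then show ?thesis
    by (metis abs_le_norm)
qed

lemma restr_lessThan_sum:
  "restr {..<N} x = (\<Sum>j<N. apply_bcontfun x j *\<^sub>R unit_seq j)"
proof (induction N)
  case 0
  show ?case
    by (auto intro!: bcontfun_eqI)
next
  case (Suc N)
  have "restr {..<Suc N} x = restr {..<N} x + apply_bcontfun x N *\<^sub>R unit_seq N"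
    by (auto intro!: bcontfun_eqI simp: less_Suc_eq)
  then show ?case
    using Suc by simp
qed

section \<open>Isometries given by a matrix\<close>

text \<open>
  The matrix has the entry \<open>S (unit_seq j) k\<close> in row \<open>k\<close> and column \<open>j\<close>. The continuity
  condition says that every row acts by summation of a series, which excludes, for instance,
  rows that are Banach limits, and thereby makes \<open>S\<close> recoverable from its matrix.
\<close>
definition matrix_isometries :: "(linfty \<Rightarrow> linfty) set" where
  "matrix_isometries = {S. linear S \<and> (\<forall>x. norm (S x) = norm x) \<and>
     (\<forall>x k. (\<lambda>N. apply_bcontfun (S (restr {..<N} x)) k) \<longlonglongrightarrow> apply_bcontfun (S x) k)}"

lemma matrix_isometries_eqI:
  assumes S: "S \<in> matrix_isometries" and R: "R \<in> matrix_isometries"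
    and eq: "\<And>j k. apply_bcontfun (S (unit_seq j)) k = apply_bcontfun (R (unit_seq j)) k"
  shows "S = R"
proof
  fix x
  have units: "S (unit_seq j) = R (unit_seq j)" for j
    by (rule bcontfun_eqI) (rule eq)
  have lin: "linear S" "linear R"
    using S R by (auto simp: matrix_isometries_def)
  have "S (restr {..<N} x) = R (restr {..<N} x)" for N
    using lin by (simp add: restr_lessThan_sum linear_sum linear_cmul units)
  then have "(\<lambda>N. apply_bcontfun (S (restr {..<N} x)) k) \<longlonglongrightarrow> apply_bcontfun (R x) k" for k
    using R by (simp add: matrix_isometries_def)
  moreover have "(\<lambda>N. apply_bcontfun (S (restr {..<N} x)) k) \<longlonglongrightarrow> apply_bcontfun (S x) k" for k
    using S by (simp add: matrix_isometries_def)
  ultimately show "S x = R x"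
    by (intro bcontfun_eqI) (rule LIMSEQ_unique)
qed

text \<open>
  A real matrix is coded by a set of natural numbers through the Dedekind cuts of its entries.
\<close>
lemma card_matrix_isometries: "|matrix_isometries| \<le>o |UNIV :: nat set set|"
proof -
  define code :: "(linfty \<Rightarrow> linfty) \<Rightarrow> nat set" where
    "code S = {to_nat (j, k, q) | j k (q :: rat). of_rat q < apply_bcontfun (S (unit_seq j)) k}" for S
  have mem: "to_nat (j, k, q) \<in> code S \<longleftrightarrow> of_rat q < apply_bcontfun (S (unit_seq j)) k"
    for S j k and q :: rat
    by (auto simp: code_def)
  have "inj_on code matrix_isometries"
  proof (rule inj_onI)
    fix S R
    assume SR: "S \<in> matrix_isometries" "R \<in> matrix_isometries" and eq: "code S = code R"
    have "apply_bcontfun (S (unit_seq j)) k = apply_bcontfun (R (unit_seq j)) k" for j k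
    proof (rule ccontr)
      let ?s = "apply_bcontfun (S (unit_seq j)) k" and ?t = "apply_bcontfun (R (unit_seq j)) k"
      assume "?s \<noteq> ?t"
      then obtain q where "?s < of_rat q \<and> of_rat q < ?t \<or> ?t < of_rat q \<and> of_rat q < ?s"
        using of_rat_dense[of ?s ?t] of_rat_dense[of ?t ?s] by (metis linorder_neqE_linordered_idom)
      then show False
        using eq mem[of j k q S] mem[of j k q R] by auto
    qed
    then show "S = R"
      using SR by (intro matrix_isometries_eqI)
  qed
  then show ?thesis
    using card_of_ordLeq by blast
qed

section \<open>Finding a matrix isometry inside an isometry\<close>

text \<open>
  Every set \<open>\<alpha>\<close> of natural numbers is a branch of the binary tree, and \<open>branch \<alpha> n\<close> is a
  code for its node at level \<open>n\<close>. Two different branches share only finitely many nodes, so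
  their ranges form an almost disjoint family of the size of the continuum.
\<close>
definition branch :: "nat set \<Rightarrow> nat \<Rightarrow> nat" where
  "branch \<alpha> n = prod_encode (n, set_encode (\<alpha> \<inter> {..<n}))"

lemma inj_branch: "inj (branch \<alpha>)"
  by (auto simp: inj_def branch_def)

lemma branch_eq_iff: "branch \<alpha> n = branch \<beta> m \<longleftrightarrow> n = m \<and> \<alpha> \<inter> {..<n} = \<beta> \<inter> {..<n}"
  by (auto simp: branch_def set_encode_eq)

text \<open>
  The tails are compared with whole branches here; this suffices since a common node has the
  same level on both branches.
\<close>
lemma branches_eventually_disjoint:
  assumes "finite F"
  obtains N where "\<And>\<alpha> \<beta> n m. \<alpha> \<in> F \<Longrightarrow> \<beta> \<in> F \<Longrightarrow> N \<le> n \<Longrightarrow> branch \<alpha> n = branch \<beta> m \<Longrightarrow> \<alpha> = \<beta>"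
proof -
  have "\<exists>d. \<forall>n\<ge>d. \<alpha> \<inter> {..<n} = \<beta> \<inter> {..<n} \<longrightarrow> \<alpha> = \<beta>" for \<alpha> \<beta> :: "nat set"
  proof (cases "\<alpha> = \<beta>")
    case False
    then obtain i where "i \<in> \<alpha> \<longleftrightarrow> i \<notin> \<beta>"
      by blast
    then have "\<forall>n\<ge>Suc i. \<alpha> \<inter> {..<n} \<noteq> \<beta> \<inter> {..<n}"
      by (auto simp: set_eq_iff Suc_le_eq)
    then show ?thesis
      by blast
  qed simp
  then obtain d where d: "\<And>(\<alpha> :: nat set) \<beta> n. d \<alpha> \<beta> \<le> n \<Longrightarrow> \<alpha> \<inter> {..<n} = \<beta> \<inter> {..<n} \<Longrightarrow> \<alpha> = \<beta>"
    by metis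
  have "d \<alpha> \<beta> \<le> (\<Sum>(\<alpha>, \<beta>)\<in>F \<times> F. d \<alpha> \<beta>)" if "\<alpha> \<in> F" "\<beta> \<in> F" for \<alpha> \<beta>
    using member_le_sum[of "(\<alpha>, \<beta>)" "F \<times> F" "\<lambda>(\<alpha>, \<beta>). d \<alpha> \<beta>"] that assms by simp
  then show ?thesis
    using that[of "\<Sum>(\<alpha>, \<beta>)\<in>F \<times> F. d \<alpha> \<beta>"] d by (meson branch_eq_iff order_trans)
qed

text \<open>
  These are the branches on which \<open>\<phi>\<close> keeps a mass of more than \<open>\<delta>\<close> at infinity.
\<close>
definition heavy_branches :: "(linfty \<Rightarrow> real) \<Rightarrow> real \<Rightarrow> nat set set" where
  "heavy_branches \<phi> \<delta> = {\<alpha>. \<exists>x. norm x \<le> 1 \<and>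
     (\<forall>N. \<exists>n\<ge>N. \<bar>\<phi> (push (branch \<alpha>) (restr {n..} x))\<bar> > \<delta>)}"

text \<open>
  Tails on different branches are disjointly supported, provided that they start late enough.
  Adding up such tails of \<open>K\<close> heavy branches with suitable signs gives a vector of norm at
  most 1 on which \<open>\<phi>\<close> is at least \<open>K * \<delta>\<close>. As \<open>\<phi>\<close> has norm at most 1, this bounds \<open>K\<close>.
\<close>
lemma finite_heavy_branches:
  assumes lin: "linear \<phi>" and bd: "\<And>z. \<bar>\<phi> z\<bar> \<le> norm z" and "\<delta> > 0"
  shows "finite (heavy_branches \<phi> \<delta>)"
proof (rule ccontr)
  assume "infinite (heavy_branches \<phi> \<delta>)"
  obtain K :: nat where K: "real K * \<delta> > 1"
    using \<open>\<delta> > 0\<close> by (metis reals_Archimedean3)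
  obtain F where F: "F \<subseteq> heavy_branches \<phi> \<delta>" "finite F" "card F = K"
    using \<open>infinite (heavy_branches \<phi> \<delta>)\<close> by (meson infinite_arbitrarily_large)
  obtain N where N: "\<And>\<alpha> \<beta> n m. \<alpha> \<in> F \<Longrightarrow> \<beta> \<in> F \<Longrightarrow> N \<le> n \<Longrightarrow> branch \<alpha> n = branch \<beta> m \<Longrightarrow> \<alpha> = \<beta>"
    using branches_eventually_disjoint[OF F(2)] by metis
  have "\<exists>x n. norm x \<le> 1 \<and> N \<le> n \<and> \<bar>\<phi> (push (branch \<alpha>) (restr {n..} x))\<bar> > \<delta>" if "\<alpha> \<in> F" for \<alpha>
    using F(1) that unfolding heavy_branches_def by blast
  then obtain x n where xn: "\<And>\<alpha>. \<alpha> \<in> F \<Longrightarrow> norm (x \<alpha>) \<le> 1"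
    "\<And>\<alpha>. \<alpha> \<in> F \<Longrightarrow> N \<le> n \<alpha>"
    "\<And>\<alpha>. \<alpha> \<in> F \<Longrightarrow> \<bar>\<phi> (push (branch \<alpha>) (restr {n \<alpha>..} (x \<alpha>)))\<bar> > \<delta>"
    by metis
  define y where "y \<alpha> = push (branch \<alpha>) (restr {n \<alpha>..} (x \<alpha>))" for \<alpha>
  define z where "z = (\<Sum>\<alpha>\<in>F. sgn (\<phi> (y \<alpha>)) *\<^sub>R y \<alpha>)"
  have y_le: "\<bar>apply_bcontfun (y \<alpha>) i\<bar> \<le> 1" if "\<alpha> \<in> F" for \<alpha> i
    using xn(1)[OF that] norm_restr_le[of "{n \<alpha>..}" "x \<alpha>"] abs_le_norm[of "y \<alpha>" i]
    by (simp add: y_def norm_push[OF inj_branch])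
  have supp: "\<exists>k\<ge>N. i = branch \<alpha> k" if "\<alpha> \<in> F" "apply_bcontfun (y \<alpha>) i \<noteq> 0" for \<alpha> i
    using that xn(2)[OF that(1)]
    by (auto simp: y_def apply_push inj_branch split: if_splits intro: order_trans)
  have "\<bar>apply_bcontfun z i\<bar> \<le> 1" for i
  proof -
    have z_i: "apply_bcontfun z i = (\<Sum>\<alpha>\<in>F. sgn (\<phi> (y \<alpha>)) * apply_bcontfun (y \<alpha>) i)"
      unfolding z_def by (induction F rule: infinite_finite_induct) auto
    show ?thesis
    proof (cases "\<exists>\<alpha>\<in>F. apply_bcontfun (y \<alpha>) i \<noteq> 0")
      case True
      then obtain \<alpha> where \<alpha>: "\<alpha> \<in> F" "apply_bcontfun (y \<alpha>) i \<noteq> 0"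
        by blast
      have zero: "apply_bcontfun (y \<beta>) i = 0" if "\<beta> \<in> F - {\<alpha>}" for \<beta>
        using supp[OF \<alpha>] supp[of \<beta> i] N[of \<alpha> \<beta>] \<alpha>(1) that by blast
      have "apply_bcontfun z i = sgn (\<phi> (y \<alpha>)) * apply_bcontfun (y \<alpha>) i"
        unfolding z_i using F(2) \<alpha>(1) zero by (subst sum.remove[of _ \<alpha>]) auto
      then show ?thesis
        using y_le[OF \<alpha>(1), of i] by (simp add: abs_mult abs_sgn_eq)
    qed (simp add: z_i)
  qed
  then have "norm z \<le> 1"
    by (rule norm_le_if_coords)
  \<comment> \<open>The signs in \<open>z\<close> turn the values of \<open>\<phi>\<close> on the summands into absolute values.\<close>
  have "real K * \<delta> \<le> (\<Sum>\<alpha>\<in>F. \<bar>\<phi> (y \<alpha>)\<bar>)"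
    unfolding F(3)[symmetric] using xn(3) by (intro sum_bounded_below) (auto simp: y_def less_imp_le)
  also have "\<dots> = \<phi> z"
    unfolding z_def using lin by (simp add: linear_sum linear_cmul abs_sgn mult.commute)
  also have "\<dots> \<le> 1"
    using bd[of z] \<open>norm z \<le> 1\<close> by linarith
  finally show False
    using K by simp
qed

text \<open>
  On a branch that is heavy for no \<open>\<delta>\<close>, the values of \<open>\<phi>\<close> on the tails of a sequence tend
  to 0.
\<close>
lemma light_branch_tendsto:
  assumes lin: "linear \<phi>" and light: "\<And>p. \<alpha> \<notin> heavy_branches \<phi> (inverse (real (Suc p)))"
  shows "(\<lambda>N. \<phi> (push (branch \<alpha>) (restr {..<N} x))) \<longlonglongrightarrow> \<phi> (push (branch \<alpha>) x)"
proof -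
  define \<psi> where "\<psi> = \<phi> \<circ> push (branch \<alpha>)"
  have "linear \<psi>"
    unfolding \<psi>_def using linear_push lin by (rule linear_compose)
  have split: "\<psi> x = \<psi> (restr {..<N} x) + \<psi> (restr {N..} x)" for N
  proof -
    have "x = restr {..<N} x + restr {N..} x"
      by (auto intro!: bcontfun_eqI)
    then show ?thesis
      using linear_add[OF \<open>linear \<psi>\<close>] by metis
  qed
  \<comment> \<open>Heaviness concerns the unit ball, so \<open>x\<close> is scaled by a factor that is positive even for \<open>x = 0\<close>.\<close>
  define c where "c = norm x + 1"
  have "c > 0"
    by (simp add: c_def add_nonneg_pos)
  have tail: "\<exists>N. \<forall>n\<ge>N. \<bar>\<psi> (restr {n..} x)\<bar> < e" if "e > 0" for e
  proof -
    obtain p where p: "inverse (real (Suc p)) < e / c"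
      using reals_Archimedean \<open>e > 0\<close> \<open>c > 0\<close> by (metis divide_pos_pos)
    have "norm (inverse c *\<^sub>R x) \<le> 1"
      using \<open>c > 0\<close> by (simp add: c_def field_simps)
    then obtain N where N: "\<And>n. n \<ge> N \<Longrightarrow> \<bar>\<psi> (restr {n..} (inverse c *\<^sub>R x))\<bar> \<le> inverse (real (Suc p))"
      using light[of p] unfolding heavy_branches_def \<psi>_def by (force simp: not_less)
    have "\<bar>\<psi> (restr {n..} x)\<bar> < e" if "n \<ge> N" for n
    proof -
      have "\<bar>\<psi> (restr {n..} x)\<bar> * inverse c \<le> inverse (real (Suc p))"
        using N[OF that] \<open>c > 0\<close>
        by (simp add: linear_cmul[OF linear_restr] linear_cmul[OF \<open>linear \<psi>\<close>] abs_mult mult.commute)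
      also note p
      finally show ?thesis
        using \<open>c > 0\<close> by (simp add: divide_inverse)
    qed
    then show ?thesis
      by blast
  qed
  have "(\<lambda>N. \<psi> (restr {..<N} x)) \<longlonglongrightarrow> \<psi> x"
  proof (rule LIMSEQ_I)
    fix e :: real
    assume "e > 0"
    then obtain N where "\<forall>n\<ge>N. \<bar>\<psi> (restr {n..} x)\<bar> < e"
      using tail by blast
    moreover have "norm (\<psi> (restr {..<n} x) - \<psi> x) = \<bar>\<psi> (restr {n..} x)\<bar>" for n
      using split[of n] by simp
    ultimately show "\<exists>N. \<forall>n\<ge>N. norm (\<psi> (restr {..<n} x) - \<psi> x) < e"
      by auto
  qed
  then show ?thesis
    by (simp add: \<psi>_def)
qed

lemma uncountable_nat_sets: "uncountable (UNIV :: nat set set)"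
proof
  assume "countable (UNIV :: nat set set)"
  then obtain f :: "nat \<Rightarrow> nat set" where "range f = UNIV"
    by (metis uncountable_def empty_not_UNIV)
  then show False
    using Cantors_theorem[of UNIV] by auto
qed

text \<open>
  The coordinates of \<open>T\<close> are countably many functionals of norm at most 1, so the branches
  that are heavy for one of them and some \<open>\<delta>\<close> form a countable set. Composing \<open>T\<close> with the
  embedding along any other branch gives the required isometry.
\<close>
lemma matrix_isometry_inside_isometry:
  fixes T :: "linfty \<Rightarrow> linfty"
  assumes lin: "linear T" and iso: "\<And>x. norm (T x) = norm x"
  obtains S where "S \<in> matrix_isometries" "range S \<subseteq> range T"
proof -
  define \<phi> where "\<phi> k z = apply_bcontfun (T z) k" for k z
  have \<phi>: "linear (\<phi> k)" "\<bar>\<phi> k z\<bar> \<le> norm z" for k z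
    using lin abs_le_norm[of "T z" k]
    by (auto intro!: linearI simp: \<phi>_def linear_add linear_cmul iso)
  define H where "H = (\<Union>k p. heavy_branches (\<phi> k) (inverse (real (Suc p))))"
  have "finite (heavy_branches (\<phi> k) (inverse (real (Suc p))))" for k p
    by (rule finite_heavy_branches[OF \<phi>]) simp
  then have "countable H"
    unfolding H_def by (intro countable_UN countableI_type countable_finite)
  have "H \<noteq> UNIV"
  proof
    assume "H = UNIV"
    with \<open>countable H\<close> show False
      using uncountable_nat_sets by (simp only:)
  qed
  then obtain \<alpha> where "\<alpha> \<notin> H"
    by blast
  then have \<alpha>: "\<alpha> \<notin> heavy_branches (\<phi> k) (inverse (real (Suc p)))" for k p
    unfolding H_def by blast
  define S where "S = T \<circ> push (branch \<alpha>)"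
  have "(\<lambda>N. apply_bcontfun (S (restr {..<N} x)) k) \<longlonglongrightarrow> apply_bcontfun (S x) k" for x k
    using light_branch_tendsto[OF \<phi>(1), of \<alpha> k x] \<alpha> by (simp add: S_def \<phi>_def)
  then have "S \<in> matrix_isometries"
    unfolding matrix_isometries_def S_def
    by (auto simp: linear_compose[OF linear_push lin] iso norm_push inj_branch)
  then show ?thesis
    by (rule that) (auto simp: S_def)
qed

section \<open>Antipodal points and the distance function\<close>

text \<open>
  Two conflicting choices of signs for \<open>S\<close> would have images less than 1 away from the same
  vector, whereas images of different sequences of signs are at distance 2.
\<close>
lemma antipodal_selection:
  obtains g :: "(linfty \<Rightarrow> linfty) \<Rightarrow> nat set" where
    "\<And>S R. S \<in> matrix_isometries \<Longrightarrow> R \<in> matrix_isometries \<Longrightarrow>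
       1 \<le> norm (S (sign_seq (g S)) + R (sign_seq (g R)))"
proof -
  define C where "C S D R E \<longleftrightarrow> norm (S (sign_seq D) + R (sign_seq E)) < 1"
    for S R :: "linfty \<Rightarrow> linfty" and D E
  have few: "D = D'" if S: "S \<in> matrix_isometries" and C: "C S D R E" "C S D' R E" for S R D D' E
  proof (rule ccontr)
    assume "D \<noteq> D'"
    have "2 \<le> norm (sign_seq D - sign_seq D')"
      by (rule norm_sign_seq_diff) fact
    also have "\<dots> = norm (S (sign_seq D - sign_seq D'))"
      using S by (simp add: matrix_isometries_def)
    also have "\<dots> = norm ((S (sign_seq D) + R (sign_seq E)) - (S (sign_seq D') + R (sign_seq E)))"
      using S by (simp add: matrix_isometries_def linear_diff)
    also have "\<dots> < 1 + 1"
      using C unfolding C_def by (intro le_less_trans[OF norm_triangle_ineq4] add_strict_mono)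
    finally show False
      by simp
  qed
  obtain g where g: "\<And>S R. S \<in> matrix_isometries \<Longrightarrow> R \<in> matrix_isometries \<Longrightarrow> S \<noteq> R \<Longrightarrow> \<not> C S (g S) R (g R)"
    using transfinite_choice_avoiding[OF card_matrix_isometries, of C] few
    by (metis C_def add.commute)
  have "1 \<le> norm (S (sign_seq (g S)) + R (sign_seq (g R)))"
    if "S \<in> matrix_isometries" "R \<in> matrix_isometries" for S R
  proof (cases "S = R")
    case True
    have "norm (S (sign_seq (g S)) + S (sign_seq (g S))) = 2 * norm (S (sign_seq (g S)))"
      by (simp flip: scaleR_2)
    then show ?thesis
      using True that by (simp add: matrix_isometries_def)
  qed (use g that in \<open>force simp: C_def\<close>)
  then show ?thesis
    by (rule that)
qed

text \<open>
  At a position where the two sequences agree, all their convex combinations have the value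
  1 or -1 and hence norm 1.
\<close>
lemma segment_agreeing_signs_in_sphere:
  assumes S: "linear S" "\<And>x. norm (S x) = norm x" and agree: "n \<in> D \<longleftrightarrow> n \<in> E"
  shows "closed_segment (S (sign_seq D)) (S (sign_seq E)) \<subseteq> sphere 0 1 \<inter> range S"
proof
  fix y
  assume "y \<in> closed_segment (S (sign_seq D)) (S (sign_seq E))"
  then obtain u where u: "0 \<le> u" "u \<le> 1" "y = (1 - u) *\<^sub>R S (sign_seq D) + u *\<^sub>R S (sign_seq E)"
    by (auto simp: in_segment)
  define z where "z = (1 - u) *\<^sub>R sign_seq D + u *\<^sub>R sign_seq E"
  have y: "y = S z"
    using S(1) by (simp add: u z_def linear_add linear_cmul)
  have "norm z \<le> (1 - u) * 1 + u * 1"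
    unfolding z_def using u by (intro norm_triangle_le) simp
  moreover have "1 \<le> norm z"
    using abs_le_norm[of z n] agree by (auto simp: z_def split: if_splits)
  ultimately show "y \<in> sphere 0 1 \<inter> range S"
    by (simp add: y S(2))
qed

theorem proposition3p3:
  shows "\<exists>f :: linfty \<Rightarrow> real.
    1-lipschitz_on (sphere 0 1) f \<and> f ` sphere 0 1 \<subseteq> {0..1} \<and>
    (\<forall>X :: linfty set. subspace X \<and> linearly_isometric_to X TYPE(linfty) \<longrightarrow>
       f ` (sphere 0 1 \<inter> X) = {0..1})"
proof -
  obtain g :: "(linfty \<Rightarrow> linfty) \<Rightarrow> nat set" where
    g: "\<And>S R. S \<in> matrix_isometries \<Longrightarrow> R \<in> matrix_isometries \<Longrightarrow>
       1 \<le> norm (S (sign_seq (g S)) + R (sign_seq (g R)))"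
    using antipodal_selection by blast
  define A where "A = (\<lambda>S. S (sign_seq (g S))) ` matrix_isometries"
  define f where "f x = min 1 (infdist x A)" for x
  have lip: "1-lipschitz_on (sphere 0 1) f"
  proof (rule lipschitz_onI)
    show "dist (f x) (f y) \<le> 1 * dist x y" for x y
      using infdist_triangle_abs[of x A y] by (auto simp: f_def dist_real_def min_def)
  qed simp
  have range: "f x \<in> {0..1}" for x
    by (auto simp: f_def infdist_nonneg)
  have onto: "{0..1} \<subseteq> f ` (sphere 0 1 \<inter> X)" if X: "linearly_isometric_to X TYPE(linfty)" for X
  proof -
    obtain T :: "linfty \<Rightarrow> linfty" where T: "linear T" "\<And>x. norm (T x) = norm x" "range T = X"
      using X unfolding linearly_isometric_to_def by blast
    obtain S where S: "S \<in> matrix_isometries" "range S \<subseteq> X"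
      using matrix_isometry_inside_isometry[OF T(1,2)] T(3) by metis
    have iso: "linear S" "\<And>x. norm (S x) = norm x"
      using S(1) by (auto simp: matrix_isometries_def)
    define a where "a = S (sign_seq (g S))"
    have "a \<in> A"
      using S(1) by (auto simp: A_def a_def)
    have f_a: "f a = 0"
      using \<open>a \<in> A\<close> by (simp add: f_def)
    have "1 \<le> dist (- a) y" if "y \<in> A" for y
      using that g[OF S(1)] norm_minus_cancel[of "a + y"] by (auto simp: A_def a_def dist_norm)
    then have "1 \<le> infdist (- a) A"
      unfolding infdist_def using \<open>a \<in> A\<close> by (auto intro: cINF_greatest)
    then have f_minus_a: "f (- a) = 1"
      by (simp add: f_def)
    have "sign_seq (- g S) = - sign_seq (g S)"
      by (auto intro!: bcontfun_eqI)
    then have minus_a: "S (sign_seq (- g S)) = - a"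
      by (simp add: a_def linear_neg[OF iso(1)])
    \<comment> \<open>\<open>sign_seq G\<close> agrees with \<open>sign_seq (g S)\<close> at position 0 and with its negative elsewhere.\<close>
    define G where "G = (if 0 \<in> g S then insert 0 (- g S) else - g S - {0})"
    define b where "b = S (sign_seq G)"
    let ?P = "closed_segment a b \<union> closed_segment b (- a)"
    have "closed_segment a b \<subseteq> sphere 0 1 \<inter> range S"
      unfolding a_def b_def by (rule segment_agreeing_signs_in_sphere[OF iso, of 0]) (auto simp: G_def)
    moreover have "closed_segment b (- a) \<subseteq> sphere 0 1 \<inter> range S"
      unfolding b_def minus_a[symmetric]
      by (rule segment_agreeing_signs_in_sphere[OF iso, of 1]) (auto simp: G_def)
    ultimately have P: "?P \<subseteq> sphere 0 1 \<inter> X"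
      using S(2) by blast
    have "connected ?P"
      by (rule connected_Un) auto
    moreover have "continuous_on ?P f"
      using lipschitz_on_continuous_on[OF lip] P by (blast intro: continuous_on_subset)
    ultimately have "connected (f ` ?P)"
      by (rule connected_continuous_image[rotated])
    moreover have "f a \<in> f ` ?P" "f (- a) \<in> f ` ?P"
      by auto
    ultimately have "{0..1} \<subseteq> f ` ?P"
      unfolding f_a f_minus_a by (rule connected_contains_Icc)
    then show ?thesis
      using P by blast
  qed
  show ?thesis
    using lip range onto by (intro exI[of _ f]) blast
qed

end
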